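(* There is a function $\delta_0 = \delta_0(n) = O((\log n)/n)$ such that the following holds. Let $n\ge 2$, $\alpha\in(0,1)$, and let $T\subseteq[n]$ be of size $\alpha n$. Let $\mathcal{F}_T$ be the family of tampering functions that only act on the coordinate positions in $T$ (defined in the context). Let $(\mathsf{Enc},\mathsf{Dec})$ be any coding scheme with block length $n$ that is non-malleable for the family $\mathcal{F}_T$ with error $\epsilon$ and achieves rate $1-\alpha+\delta$, for any $\delta\in[\delta_0,\alpha]$. Then $$\epsilon \ge \frac{\delta}{16\alpha}.$$ In particular, when $\alpha$ and $\delta$ are absolute constants, $\epsilon = \Omega(1)$.
   Context: For $T\subseteq[n]$ and $x\in\{0,1\}^n$, write $x_T\in\{0,1\}^{|T|}$ for the restriction of $x$ to the positions in $T$, and $\bar T := [n]\setminus T$; write $x = (x_T,x_{\bar T})$ (after reordering coordinates). $\mathcal{F}_T$ is the family of all functions $f\colon\{0,1\}^n\to\{0,1\}^n$ of the form $f(x) = (g(x_T),x_{\bar T})$ for some $g\colon\{0,1\}^{|T|}\to\{0,1\}^{|T|}$. Coding scheme. A coding scheme with block length $n$ and message length $k\le n$ is a pair $\mathsf{Enc}\colon \{0,1\}^k \to \{0,1\}^n$, $\mathsf{Dec}\colon \{0,1\}^n \to \{0,1\}^k \cup \{\perp\}$, where $\mathsf{Enc}$ is randomized (using uniform internal coin flips), $\mathsf{Dec}$ is deterministic, and $\mathsf{Dec}(\mathsf{Enc}(s)) = s$ with probability $1$ for every $s\in\{0,1\}^k$. Its rate is $k/n$. Non-malleability. For a special symbol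 $\mathsf{same}$, let $\mathrm{copy}(x,y) := x$ if $x\ne\mathsf{same}$ and $\mathrm{copy}(\mathsf{same},y) := y$. A coding scheme is non-malleable with error $\epsilon$ with respect to a family $\mathcal{F}$ of functions $\{0,1\}^n\to\{0,1\}^n$ if for every $f\in\mathcal{F}$ there is a distribution $\mathcal{D}_f$ over $\{0,1\}^k\cup\{\perp,\mathsf{same}\}$ such that for every $s\in\{0,1\}^k$, the distribution of $\mathsf{Dec}(f(\mathsf{Enc}(s)))$ is within statistical (total variation) distance $\epsilon$ of the distribution of $\mathrm{copy}(S',s)$, where $S'\sim\mathcal{D}_f$. *)

theory Defs
  imports "HOL-Probability.Probability"
begin

text \<open>Bit strings are lists of booleans; the coordinate positions \<open>[n]\<close> are \<open>{..<n}\<close>,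
  and the restriction \<open>x\<^sub>T\<close> is \<^term>\<open>nths x T\<close>.\<close>

definition bitstrings :: "nat \<Rightarrow> bool list set" where
  "bitstrings n = {x. length x = n}"

text \<open>The two equations on \<^const>\<open>nths\<close>, together with the length of \<open>f x\<close>, say that
  \<open>f x\<close> is \<open>(g x\<^sub>T, x\<^sub>T\<^sub>')\<close> up to reordering of coordinates, where \<open>T'\<close> is the complement of \<open>T\<close>
  in \<open>[n]\<close>. The values of \<open>f\<close> outside \<open>{0,1}\<^sup>n\<close> are unconstrained, and never used.\<close>

definition tampering_on :: "nat \<Rightarrow> nat set \<Rightarrow> (bool list \<Rightarrow> bool list) set" where
  "tampering_on n T = {f. \<exists>g.
     (\<forall>y\<in>bitstrings (card T). g y \<in> bitstrings (card T)) \<and>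
     (\<forall>x\<in>bitstrings n. f x \<in> bitstrings n \<and>
        nths (f x) T = g (nths x T) \<and>
        nths (f x) ({..<n} - T) = nths x ({..<n} - T))}"

text \<open>A randomized encoder is represented by the output distribution \<open>Enc s\<close> on each message
  \<open>s\<close>. It is sampled by an arbitrary measurable function of an infinite sequence of fair coin
  flips, so no bound on the number of flips actually used is imposed.\<close>

definition fair_coins :: "bool stream measure" where
  "fair_coins = stream_space (measure_pmf (bernoulli_pmf (1 / 2)))"

definition sampled_by_coins :: "'a pmf \<Rightarrow> bool" where
  "sampled_by_coins p \<longleftrightarrow> (\<exists>e. e \<in> fair_coins \<rightarrow>\<^sub>M count_space UNIV \<and>
     measure_pmf p = distr fair_coins (count_space UNIV) e)"

text \<open>In the type of the decoder, \<^const>\<open>None\<close> is the symbol \<open>\<bottom>\<close>.\<close>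

definition coding_scheme ::
  "nat \<Rightarrow> nat \<Rightarrow> (bool list \<Rightarrow> bool list pmf) \<Rightarrow> (bool list \<Rightarrow> bool list option) \<Rightarrow> bool" where
  "coding_scheme n k Enc Dec \<longleftrightarrow>
     k \<le> n \<and>
     (\<forall>s\<in>bitstrings k. set_pmf (Enc s) \<subseteq> bitstrings n \<and> sampled_by_coins (Enc s)) \<and>
     (\<forall>x\<in>bitstrings n. Dec x \<in> insert None (Some ` bitstrings k)) \<and>
     (\<forall>s\<in>bitstrings k. measure_pmf.prob (Enc s) {x. Dec x = Some s} = 1)"

definition rate :: "nat \<Rightarrow> nat \<Rightarrow> real" where
  "rate n k = real k / real n"

definition statistical_distance :: "'a pmf \<Rightarrow> 'a pmf \<Rightarrow> real" where
  "statistical_distance p q =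
     (SUP A. \<bar>measure_pmf.prob p A - measure_pmf.prob q A\<bar>)"

datatype 'a or_same = Same | Val 'a

fun copy_or_same :: "'a or_same \<Rightarrow> 'a \<Rightarrow> 'a" where
  "copy_or_same Same y = y"
| "copy_or_same (Val x) y = x"

definition non_malleable ::
  "nat \<Rightarrow> (bool list \<Rightarrow> bool list pmf) \<Rightarrow> (bool list \<Rightarrow> bool list option)
     \<Rightarrow> (bool list \<Rightarrow> bool list) set \<Rightarrow> real \<Rightarrow> bool" where
  "non_malleable k Enc Dec F \<epsilon> \<longleftrightarrow>
     (\<forall>f\<in>F. \<exists>D :: bool list option or_same pmf.
        set_pmf D \<subseteq> insert Same (Val ` insert None (Some ` bitstrings k)) \<and>
        (\<forall>s\<in>bitstrings k.
           statistical_distance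
             (map_pmf (\<lambda>x. Dec (f x)) (Enc s))
             (map_pmf (\<lambda>S'. copy_or_same S' (Some s)) D) \<le> \<epsilon>))"

end

theory Submission
  imports Defs "HOL-Real_Asymp.Real_Asymp"
begin

text \<open>
  Write \<open>t = |T|\<close>. The positions outside \<open>T\<close> carry only \<open>n - t\<close> bits, so a given value of \<open>x\<^sub>T\<close> is
  compatible with at most \<open>2\<^sup>n\<^sup>-\<^sup>t\<close> of the \<open>2\<^sup>k\<close> messages, a small fraction once \<open>k \<ge> n - t + 2\<close>.
  Fix a message \<open>s0\<close> that has at most \<open>2\<^sup>n\<^sup>-\<^sup>k\<close> preimages under the decoder. By averaging there are a
  string \<open>z\<close> and a message \<open>s1 \<noteq> s0\<close> such that on the encoding of \<open>s0\<close> the following adversary produces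
  a string decoding to \<open>s0\<close> or \<open>s1\<close> with probability at most \<open>7/12\<close>: leave \<open>x\<close> alone if \<open>x\<^sub>T\<close> is compatible with \<open>s1\<close>, and otherwise
  overwrite \<open>x\<^sub>T\<close> by \<open>z\<^sub>T\<close>. It never modifies an encoding of \<open>s1\<close>, so the simulator must put mass
  at least \<open>1 - \<epsilon>\<close> on \<open>same\<close> and \<open>s1\<close>; on \<open>s0\<close> both of these yield \<open>s0\<close> or \<open>s1\<close>. This forces \<open>\<epsilon>\<close>
  to be at least \<open>5/24\<close>, which exceeds \<open>\<delta>/(16\<alpha>)\<close>; the threshold \<open>\<delta>\<^sub>0 = 2/n\<close>
  suffices.
\<close>

section \<open>Counting bit strings with a prescribed restriction\<close>

lemma bitstrings_eq_lists: "bitstrings n = {xs. set xs \<subseteq> UNIV \<and> length xs = n}"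
  by (simp add: bitstrings_def)

lemma finite_bitstrings [simp]: "finite (bitstrings n)"
  unfolding bitstrings_eq_lists by (rule finite_lists_length_eq) simp

lemma card_bitstrings [simp]: "card (bitstrings n) = 2 ^ n"
  unfolding bitstrings_eq_lists by (subst card_lists_length_eq) simp_all

lemma nths_eq_iff_nth_eq:
  assumes "length xs = length ys"
  shows "nths xs I = nths ys I \<longleftrightarrow> (\<forall>i<length xs. i \<in> I \<longrightarrow> xs ! i = ys ! i)"
  using assms
proof (induction xs ys arbitrary: I rule: list_induct2)
  case Nil
  then show ?case by simp
next
  case (Cons x xs y ys)
  have len: "length (nths xs {j. Suc j \<in> I}) = length (nths ys {j. Suc j \<in> I})"
    using Cons.hyps by (simp add: length_nths)
  show ?case
    using Cons.IH[of "{j. Suc j \<in> I}"] len by (auto simp: nths_Cons All_less_Suc2)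
qed

text \<open>The entries on \<open>T\<close> are fixed and the other \<open>n - card T\<close> are
  free, so the fiber is parametrized by the set of positions outside \<open>T\<close> that carry a
  one.\<close>

lemma card_nths_fiber:
  assumes T: "T \<subseteq> {..<n}" and x: "x \<in> bitstrings n"
  shows "card {z \<in> bitstrings n. nths z T = nths x T} = 2 ^ (n - card T)"
proof -
  define h where "h S = map (\<lambda>i. if i \<in> T then x ! i else i \<in> S) [0..<n]" for S
  have lx: "length x = n" using x by (simp add: bitstrings_def)
  have eq: "nths z T = nths x T \<longleftrightarrow> (\<forall>i<n. i \<in> T \<longrightarrow> z ! i = x ! i)" if "length z = n" for z
    using nths_eq_iff_nth_eq[of z x T] that lx by simp
  have "bij_betw h (Pow ({..<n} - T)) {z \<in> bitstrings n. nths z T = nths x T}"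
  proof (rule bij_betw_byWitness[where f' = "\<lambda>z. {i. i < n \<and> i \<notin> T \<and> z ! i}"])
    show "\<forall>S\<in>Pow ({..<n} - T). {i. i < n \<and> i \<notin> T \<and> h S ! i} = S"
      by (auto simp: h_def)
    show "\<forall>z\<in>{z \<in> bitstrings n. nths z T = nths x T}. h {i. i < n \<and> i \<notin> T \<and> z ! i} = z"
      by (auto simp: bitstrings_def eq h_def intro!: nth_equalityI)
    show "h ` Pow ({..<n} - T) \<subseteq> {z \<in> bitstrings n. nths z T = nths x T}"
      using T by (auto simp: bitstrings_def eq h_def)
  qed auto
  then have "card {z \<in> bitstrings n. nths z T = nths x T} = card (Pow ({..<n} - T))"
    by (simp add: bij_betw_same_card)
  also have "\<dots> = 2 ^ (n - card T)"
    using T by (simp add: card_Pow card_Diff_subset finite_subset)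
  finally show ?thesis .
qed

section \<open>Overwriting the coordinates in \<open>T\<close>\<close>

definition overwrite :: "nat \<Rightarrow> nat set \<Rightarrow> bool list \<Rightarrow> bool list \<Rightarrow> bool list" where
  "overwrite n T z x = map (\<lambda>i. if i \<in> T then z ! i else x ! i) [0..<n]"

lemma overwrite_in_bitstrings [simp]: "overwrite n T z x \<in> bitstrings n"
  by (simp add: overwrite_def bitstrings_def)

lemma nths_overwrite:
  assumes "z \<in> bitstrings n" shows "nths (overwrite n T z x) T = nths z T"
  using assms nths_eq_iff_nth_eq[of "overwrite n T z x" z T]
  by (simp add: overwrite_def bitstrings_def)

lemma nths_overwrite_compl:
  assumes "x \<in> bitstrings n"
  shows "nths (overwrite n T z x) ({..<n} - T) = nths x ({..<n} - T)"
  using assms nths_eq_iff_nth_eq[of "overwrite n T z x" x "{..<n} - T"]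
  by (simp add: overwrite_def bitstrings_def)

text \<open>Overwriting forgets only the part of \<open>z\<close> outside \<open>T\<close>, and the
  reference string \<open>y\<close> makes that part common to all members of the set.\<close>

lemma inj_on_overwrite:
  "inj_on (\<lambda>z. overwrite n T z x) {z \<in> bitstrings n. nths z ({..<n} - T) = nths y ({..<n} - T)}"
proof (rule inj_onI)
  fix z z'
  assume z: "z \<in> {z \<in> bitstrings n. nths z ({..<n} - T) = nths y ({..<n} - T)}"
    and z': "z' \<in> {z \<in> bitstrings n. nths z ({..<n} - T) = nths y ({..<n} - T)}"
    and eq: "overwrite n T z x = overwrite n T z' x"
  from z z' have len: "length z = n" "length z' = n"
    and "nths z ({..<n} - T) = nths z' ({..<n} - T)"
    by (auto simp: bitstrings_def)
  then have off: "\<forall>i<n. i \<notin> T \<longrightarrow> z ! i = z' ! i"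
    using nths_eq_iff_nth_eq[of z z' "{..<n} - T"] by auto
  have "z ! i = z' ! i" if "i < n" "i \<in> T" for i
    using arg_cong[OF eq, of "\<lambda>y. y ! i"] that by (simp add: overwrite_def)
  with off len show "z = z'"
    by (intro nth_equalityI) auto
qed

text \<open>The test reads only \<open>nths x T\<close>, so both branches come from one map on the
  \<open>T\<close>-part: the identity on \<open>B\<close> and the constant \<open>nths z T\<close>
  elsewhere.\<close>

lemma tampering_on_overwrite_if:
  assumes T: "T \<subseteq> {..<n}" and z: "z \<in> bitstrings n"
  shows "(\<lambda>x. if nths x T \<in> B then x else overwrite n T z x) \<in> tampering_on n T"
proof -
  have "length (nths z T) = card T"
  proof -
    have "{i. i < n \<and> i \<in> T} = T" using T by auto
    then show ?thesis using z by (simp add: length_nths bitstrings_def)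
  qed
  then show ?thesis
    unfolding tampering_on_def
    by (intro CollectI exI[of _ "\<lambda>u. if u \<in> B then u else nths z T"])
       (use z in \<open>auto simp: nths_overwrite nths_overwrite_compl bitstrings_def[of "card T"]\<close>)
qed

section \<open>Averaging, statistical distance and decoding\<close>

lemma exists_prob_le_average:
  fixes p :: "'a pmf" and c :: real
  assumes F: "finite F" "F \<noteq> {}"
    and card_le: "\<And>x. x \<in> set_pmf p \<Longrightarrow> real (card {a \<in> F. R a x}) \<le> c"
  obtains a where "a \<in> F" "measure_pmf.prob p {x. R a x} \<le> c / card F"
proof -
  have int: "integrable (measure_pmf p) (\<lambda>x. indicator {x. R a x} x :: real)" for a
    by (rule measure_pmf.integrable_const_bound[where B = 1]) auto
  \<comment> \<open>Linearity turns the sum of the probabilities into the expected number of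
    \<open>a\<close> related to \<open>x\<close>, which is at most \<open>c\<close> on the
    support.\<close>
  have "(\<Sum>a\<in>F. measure_pmf.prob p {x. R a x})
      = measure_pmf.expectation p (\<lambda>x. \<Sum>a\<in>F. indicator {x. R a x} x)"
    by (subst Bochner_Integration.integral_sum) (auto intro: int)
  also have "\<dots> \<le> measure_pmf.expectation p (\<lambda>x. c)"
  proof (rule integral_mono_AE)
    have "(\<Sum>a\<in>F. indicator {x. R a x} x :: real) = card {a \<in> F. R a x}" for x
      using F(1) by (simp add: indicator_def sum.If_cases Int_def)
    with card_le show "AE x in measure_pmf p. (\<Sum>a\<in>F. indicator {x. R a x} x) \<le> c"
      by (simp add: AE_measure_pmf_iff)
  qed (auto intro: int)
  finally have sum_le: "(\<Sum>a\<in>F. measure_pmf.prob p {x. R a x}) \<le> c"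
    by simp
  have "\<exists>a\<in>F. measure_pmf.prob p {x. R a x} \<le> c / card F"
  proof (rule ccontr)
    assume "\<not> (\<exists>a\<in>F. measure_pmf.prob p {x. R a x} \<le> c / card F)"
    then have "(\<Sum>a\<in>F. c / card F) < (\<Sum>a\<in>F. measure_pmf.prob p {x. R a x})"
      using F by (intro sum_strict_mono) auto
    with sum_le F show False by simp
  qed
  with that show thesis by blast
qed

text \<open>A real supremum dominates its members once the set is bounded above; here 1 is a
  bound.\<close>

lemma prob_diff_le_statistical_distance:
  "\<bar>measure_pmf.prob p A - measure_pmf.prob q A\<bar> \<le> statistical_distance p q"
proof -
  have "\<bar>measure_pmf.prob p B - measure_pmf.prob q B\<bar> \<le> 1" for B
    using measure_pmf.prob_le_1[of p B] measure_pmf.prob_le_1[of q B]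
      measure_nonneg[of p B] measure_nonneg[of q B] by linarith
  then have "bdd_above (range (\<lambda>A. \<bar>measure_pmf.prob p A - measure_pmf.prob q A\<bar>))"
    by (auto intro!: bdd_aboveI)
  then show ?thesis
    unfolding statistical_distance_def by (rule cSUP_upper[OF UNIV_I])
qed

lemma coding_scheme_decode:
  assumes "coding_scheme n k Enc Dec" "s \<in> bitstrings k" "x \<in> set_pmf (Enc s)"
  shows "x \<in> bitstrings n" "Dec x = Some s"
proof -
  show "x \<in> bitstrings n" using assms by (auto simp: coding_scheme_def)
  have "measure_pmf.prob (Enc s) {x. Dec x = Some s} = 1"
    using assms by (simp add: coding_scheme_def)
  then have "AE x in Enc s. Dec x = Some s"
    by (simp add: measure_pmf.prob_eq_1)
  with assms(3) show "Dec x = Some s" by (simp add: AE_measure_pmf_iff)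
qed

text \<open>Pigeonhole: the preimages of the 2^k messages are disjoint and lie in a set of size
  2^n.\<close>

lemma exists_small_preimage:
  assumes "k \<le> n"
  obtains s where "s \<in> bitstrings k" "card {x \<in> bitstrings n. Dec x = Some s} \<le> 2 ^ (n - k)"
proof -
  have "\<exists>s\<in>bitstrings k. card {x \<in> bitstrings n. Dec x = Some s} \<le> 2 ^ (n - k)"
  proof (rule ccontr)
    assume "\<not> ?thesis"
    moreover have "replicate k False \<in> bitstrings k" by (simp add: bitstrings_def)
    ultimately have "(\<Sum>s\<in>bitstrings k. 2 ^ (n - k))
        < (\<Sum>s\<in>bitstrings k. card {x \<in> bitstrings n. Dec x = Some s})"
      by (intro sum_strict_mono) auto
    also have "\<dots> = card (\<Union>s\<in>bitstrings k. {x \<in> bitstrings n. Dec x = Some s})"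
      by (rule card_UN_disjoint[symmetric]) auto
    also have "\<dots> \<le> card (bitstrings n)"
      by (intro card_mono) auto
    finally show False
      using assms by (simp flip: power_add)
  qed
  with that show thesis by blast
qed

section \<open>The adversary\<close>

lemma exists_adversary:
  assumes T: "T \<subseteq> {..<n}" and code: "coding_scheme n k Enc Dec" and k: "k \<ge> n - card T + 2"
  obtains f s0 s1 where "f \<in> tampering_on n T" "s0 \<in> bitstrings k" "s1 \<in> bitstrings k"
    "s0 \<noteq> s1"
    "\<And>x. x \<in> set_pmf (Enc s1) \<Longrightarrow> Dec (f x) = Some s1"
    "measure_pmf.prob (Enc s0) {x. Dec (f x) \<in> {Some s0, Some s1}} \<le> 7 / 12"
proof -
  have kn: "k \<le> n" using code by (simp add: coding_scheme_def)
  have tn: "card T \<le> n" using card_mono[OF finite_lessThan T] by simp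
  obtain s0 where s0: "s0 \<in> bitstrings k"
    and small: "card {x \<in> bitstrings n. Dec x = Some s0} \<le> 2 ^ (n - k)"
    using exists_small_preimage[OF kn] .
  \<comment> \<open>All \<open>z\<close> in \<open>F\<close> agree off \<open>T\<close>, where
    \<open>overwrite\<close> ignores them, so each filling of the \<open>T\<close>-part is counted
    exactly once.\<close>
  define F where "F = {z \<in> bitstrings n.
    nths z ({..<n} - T) = nths (replicate n False) ({..<n} - T)}"
  have cardF: "card F = 2 ^ card T"
    unfolding F_def using T tn card_nths_fiber[of "{..<n} - T" n "replicate n False"]
    by (simp add: bitstrings_def card_Diff_subset finite_subset)
  have finF: "finite F" by (simp add: F_def)
  have neF: "F \<noteq> {}" using cardF by auto
  obtain z where "z \<in> F"
    and prob_s0: "measure_pmf.prob (Enc s0) {x. Dec (overwrite n T z x) = Some s0}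
      \<le> 2 ^ (n - k) / card F"
  proof (rule exists_prob_le_average[OF finF neF,
        where p = "Enc s0" and R = "\<lambda>z x. Dec (overwrite n T z x) = Some s0"])
    fix x
    \<comment> \<open>For fixed \<open>x\<close>, distinct \<open>z\<close> in \<open>F\<close>
      produce distinct strings, so at most as many \<open>z\<close> hit \<open>s0\<close> as
      \<open>s0\<close> has preimages.\<close>
    have "card {z \<in> F. Dec (overwrite n T z x) = Some s0}
        \<le> card {x \<in> bitstrings n. Dec x = Some s0}"
    proof (rule card_inj_on_le[where f = "\<lambda>z. overwrite n T z x"])
      show "inj_on (\<lambda>z. overwrite n T z x) {z \<in> F. Dec (overwrite n T z x) = Some s0}"
        using inj_on_overwrite by (rule inj_on_subset) (auto simp: F_def)
    qed auto
    with small have "card {z \<in> F. Dec (overwrite n T z x) = Some s0} \<le> 2 ^ (n - k)"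
      by linarith
    then have "real (card {z \<in> F. Dec (overwrite n T z x) = Some s0}) \<le> real (2 ^ (n - k))"
      by (simp only: of_nat_le_iff)
    then show "real (card {z \<in> F. Dec (overwrite n T z x) = Some s0}) \<le> 2 ^ (n - k)"
      by simp
  qed auto
  have z: "z \<in> bitstrings n" using \<open>z \<in> F\<close> by (simp add: F_def)
  \<comment> \<open>The two spare message bits in \<open>k\<close> give
    \<open>n - k + 2 \<le> card T\<close>, hence the factor 1/4.\<close>
  have "(2::real) ^ (n - k) * 2 ^ 2 \<le> 2 ^ card T"
    unfolding power_add[symmetric] using k kn tn by (intro power_increasing) auto
  then have "(2::real) ^ (n - k) / card F \<le> 1 / 4"
    by (simp add: cardF field_simps)
  with prob_s0 have prob_s0:
    "measure_pmf.prob (Enc s0) {x. Dec (overwrite n T z x) = Some s0} \<le> 1 / 4"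
    by linarith

  \<comment> \<open>Defined from all strings decoding to \<open>s\<close>, so that the compatible
    messages are found by decoding the fiber over \<open>nths x T\<close>.\<close>
  define compatible where "compatible s = {nths x T | x. x \<in> bitstrings n \<and> Dec x = Some s}" for s
  define G where "G = bitstrings k - {s0}"
  have finG: "finite G" by (simp add: G_def)
  \<comment> \<open>With m = 2^(n - card T) \<ge> 1, the count is 2^k - 1 \<ge> 4m - 1 \<ge>
    3m.\<close>
  have "(2::nat) ^ (n - card T + 2) \<le> 2 ^ k"
    using k by (intro power_increasing) auto
  moreover have "(1::nat) \<le> 2 ^ (n - card T)" by simp
  moreover have "card G = 2 ^ k - 1"
    using s0 by (simp add: G_def)
  ultimately have cardG: "3 * 2 ^ (n - card T) \<le> card G"
    unfolding power_add by simp
  have neG: "G \<noteq> {}" using cardG by auto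
  \<comment> \<open>Since \<open>z\<close> is already fixed, overwriting into \<open>s1\<close> can
    be averaged over \<open>s1\<close> together with compatibility.\<close>
  obtain s1 where "s1 \<in> G" and prob_s1: "measure_pmf.prob (Enc s0)
      {x. nths x T \<in> compatible s1 \<or> Dec (overwrite n T z x) = Some s1} \<le> 2 ^ (n - card T) / card G"
  proof (rule exists_prob_le_average[OF finG neG, where p = "Enc s0"
        and R = "\<lambda>s x. nths x T \<in> compatible s \<or> Dec (overwrite n T z x) = Some s"])
    fix x assume x: "x \<in> set_pmf (Enc s0)"
    note dec = coding_scheme_decode[OF code s0 x]
    define C where "C = {y \<in> bitstrings n. nths y T = nths x T}"
    \<comment> \<open>The string \<open>x\<close> decodes to \<open>s0\<close>, which is not in
      \<open>G\<close>; removing it from the fiber makes room for the overwritten string, so the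
      count does not exceed the size of the fiber.\<close>
    have "{s \<in> G. nths x T \<in> compatible s \<or> Dec (overwrite n T z x) = Some s}
        \<subseteq> (\<lambda>y. the (Dec y)) ` insert (overwrite n T z x) (C - {x})" (is "?L \<subseteq> _ ` ?Y")
    proof
      fix s assume s: "s \<in> ?L"
      then have "\<exists>y\<in>?Y. Dec y = Some s"
      proof (cases "Dec (overwrite n T z x) = Some s")
        case False
        with s obtain y where "y \<in> bitstrings n" "Dec y = Some s" "nths y T = nths x T"
          by (auto simp: compatible_def)
        moreover from this have "y \<noteq> x" using s dec by (auto simp: G_def)
        ultimately show ?thesis by (auto simp: C_def)
      qed auto
      then show "s \<in> (\<lambda>y. the (Dec y)) ` ?Y" by force
    qed
    then have "card ?L \<le> card ?Y"
      by (rule surj_card_le[rotated]) (simp add: C_def)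
    also have "\<dots> \<le> Suc (card (C - {x}))"
      by (rule card_insert_le_m1) auto
    also have "\<dots> = card C"
      using dec by (intro card_Suc_Diff1) (auto simp: C_def)
    also have "\<dots> = 2 ^ (n - card T)"
      unfolding C_def by (rule card_nths_fiber[OF T dec(1)])
    finally have "real (card ?L) \<le> real (2 ^ (n - card T))"
      by (simp only: of_nat_le_iff)
    then show "real (card ?L) \<le> 2 ^ (n - card T)" by simp
  qed auto
  have s1: "s1 \<in> bitstrings k" "s0 \<noteq> s1" using \<open>s1 \<in> G\<close> by (auto simp: G_def)
  have "real (3 * 2 ^ (n - card T)) \<le> real (card G)"
    using cardG by (simp only: of_nat_le_iff)
  then have "(2::real) ^ (n - card T) / card G \<le> 1 / 3"
    using neG finG by (simp add: field_simps card_gt_0_iff)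
  with prob_s1 have prob_s1: "measure_pmf.prob (Enc s0)
      {x. nths x T \<in> compatible s1 \<or> Dec (overwrite n T z x) = Some s1} \<le> 1 / 3"
    by linarith

  define f where "f x = (if nths x T \<in> compatible s1 then x else overwrite n T z x)" for x
  \<comment> \<open>Where \<open>f\<close> keeps \<open>x\<close>, compatibility puts
    \<open>x\<close> in the second event; elsewhere the overwritten string decodes to
    \<open>s0\<close> or \<open>s1\<close>, one for each event.\<close>
  have "measure_pmf.prob (Enc s0) {x. Dec (f x) \<in> {Some s0, Some s1}}
      \<le> measure_pmf.prob (Enc s0) ({x. Dec (overwrite n T z x) = Some s0} \<union>
          {x. nths x T \<in> compatible s1 \<or> Dec (overwrite n T z x) = Some s1})"
    by (intro measure_pmf.finite_measure_mono) (auto simp: f_def)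
  also have "\<dots> \<le> 1 / 4 + 1 / 3"
    using prob_s0 prob_s1 by (intro order_trans[OF measure_subadditive]) auto
  finally have "measure_pmf.prob (Enc s0) {x. Dec (f x) \<in> {Some s0, Some s1}} \<le> 7 / 12"
    by simp
  moreover have "f \<in> tampering_on n T"
    unfolding f_def by (rule tampering_on_overwrite_if[OF T z])
  moreover have "Dec (f x) = Some s1" if "x \<in> set_pmf (Enc s1)" for x
    using coding_scheme_decode[OF code s1(1) that] by (auto simp: f_def compatible_def)
  ultimately show thesis
    using that s0 s1 by blast
qed

lemma non_malleable_error_lower_bound:
  assumes T: "T \<subseteq> {..<n}" and code: "coding_scheme n k Enc Dec" and k: "k \<ge> n - card T + 2"
    and nm: "non_malleable k Enc Dec (tampering_on n T) \<epsilon>"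
  shows "\<epsilon> \<ge> 5 / 24"
proof -
  obtain f s0 s1 where f: "f \<in> tampering_on n T"
    and s: "s0 \<in> bitstrings k" "s1 \<in> bitstrings k" "s0 \<noteq> s1"
    and dec1: "\<And>x. x \<in> set_pmf (Enc s1) \<Longrightarrow> Dec (f x) = Some s1"
    and prob0: "measure_pmf.prob (Enc s0) {x. Dec (f x) \<in> {Some s0, Some s1}} \<le> 7 / 12"
    using exists_adversary[OF T code k] by blast
  obtain D where D: "\<And>s. s \<in> bitstrings k \<Longrightarrow> statistical_distance
      (map_pmf (\<lambda>x. Dec (f x)) (Enc s)) (map_pmf (\<lambda>S'. copy_or_same S' (Some s)) D) \<le> \<epsilon>"
    using nm f unfolding non_malleable_def by blast
  let ?out = "\<lambda>s. map_pmf (\<lambda>x. Dec (f x)) (Enc s)"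
  let ?sim = "\<lambda>s. map_pmf (\<lambda>S'. copy_or_same S' (Some s)) D"
  have close: "\<bar>measure_pmf.prob (?out s) A - measure_pmf.prob (?sim s) A\<bar> \<le> \<epsilon>"
    if "s \<in> bitstrings k" for s A
    using order_trans[OF prob_diff_le_statistical_distance D[OF that]] .
  have copy1: "copy_or_same S' (Some s1) = Some s1 \<longleftrightarrow> S' = Same \<or> S' = Val (Some s1)" for S'
    by (cases S') auto
  have "measure_pmf.prob (?out s1) {Some s1} = 1"
    using dec1 by (subst measure_pmf.prob_eq_1) (auto simp: AE_measure_pmf_iff)
  then have "1 - \<epsilon> \<le> measure_pmf.prob (?sim s1) {Some s1}"
    using close[OF s(2), of "{Some s1}"] by linarith
  also have "\<dots> \<le> measure_pmf.prob (?sim s0) {Some s0, Some s1}"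
    unfolding measure_map_pmf
    by (intro measure_pmf.finite_measure_mono) (auto simp: copy1)
  also have "\<dots> \<le> measure_pmf.prob (?out s0) {Some s0, Some s1} + \<epsilon>"
    using close[OF s(1), of "{Some s0, Some s1}"] by linarith
  also have "\<dots> \<le> 7 / 12 + \<epsilon>"
    using prob0 by (simp add: vimage_def)
  \<comment> \<open>The chain reads 1 - \<epsilon> \<le> 7/12 + \<epsilon>.\<close>
  finally show ?thesis by simp
qed

text \<open>Since k = n - card T + \<delta> n, the lower bound on \<delta> provides the two spare
  message bits, while \<delta> \<le> \<alpha> caps the claimed bound at 1/16, below 5/24.\<close>

lemma non_malleable_rate_bound:
  fixes n k :: nat and \<alpha> \<delta> \<epsilon> :: real
  assumes n: "n \<ge> 2" and T: "T \<subseteq> {..<n}" "real (card T) = \<alpha> * real n"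
    and code: "coding_scheme n k Enc Dec"
    and nm: "non_malleable k Enc Dec (tampering_on n T) \<epsilon>"
    and \<delta>: "2 / real n \<le> \<delta>" "\<delta> \<le> \<alpha>" and rate: "rate n k = 1 - \<alpha> + \<delta>"
  shows "\<epsilon> \<ge> \<delta> / (16 * \<alpha>)"
proof -
  have "card T \<le> n" using card_mono[OF finite_lessThan T(1)] by simp
  have "real k = (1 - \<alpha> + \<delta>) * real n"
    using rate n by (simp add: rate_def field_simps)
  then have "real k = real n - real (card T) + \<delta> * real n"
    by (simp add: T(2) algebra_simps)
  moreover have "2 \<le> \<delta> * real n" using \<delta>(1) n by (simp add: field_simps)
  ultimately have "k \<ge> n - card T + 2"
    using \<open>card T \<le> n\<close> by linarith
  then have "5 / 24 \<le> \<epsilon>"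
    by (rule non_malleable_error_lower_bound[OF T(1) code _ nm])
  moreover have "\<delta> / (16 * \<alpha>) \<le> 1 / 16"
  proof -
    have "0 < 2 / real n" using n by simp
    with \<delta> have "0 < \<alpha>" by linarith
    with \<delta> show ?thesis by (simp add: field_simps)
  qed
  ultimately show ?thesis by linarith
qed

theorem theorem5p3:
  shows "(\<exists>\<delta>\<^sub>0 :: nat \<Rightarrow> real.
      \<delta>\<^sub>0 \<in> O(\<lambda>n. ln (real n) / real n) \<and>
      (\<forall>(n::nat) (k::nat) (\<alpha>::real) (\<delta>::real) (\<epsilon>::real) (T::nat set)
          (Enc :: bool list \<Rightarrow> bool list pmf) (Dec :: bool list \<Rightarrow> bool list option).
         n \<ge> 2 \<and> \<alpha> \<in> {0<..<1} \<and>
         T \<subseteq> {..<n} \<and> real (card T) = \<alpha> * real n \<and>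
         coding_scheme n k Enc Dec \<and>
         non_malleable k Enc Dec (tampering_on n T) \<epsilon> \<and>
         \<delta> \<in> {\<delta>\<^sub>0 n..\<alpha>} \<and> rate n k = 1 - \<alpha> + \<delta>
         \<longrightarrow> \<epsilon> \<ge> \<delta> / (16 * \<alpha>)))
    \<and>
    (\<forall>(\<alpha>::real) (\<delta>::real). \<alpha> \<in> {0<..<1} \<and> \<delta> \<in> {0<..\<alpha>} \<longrightarrow>
      (\<exists>c>0. \<forall>\<^sub>F n in sequentially.
        \<forall>(k::nat) (\<epsilon>::real) (T::nat set)
          (Enc :: bool list \<Rightarrow> bool list pmf) (Dec :: bool list \<Rightarrow> bool list option).
         T \<subseteq> {..<n} \<and> real (card T) = \<alpha> * real n \<and>
         coding_scheme n k Enc Dec \<and>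
         non_malleable k Enc Dec (tampering_on n T) \<epsilon> \<and>
         rate n k = 1 - \<alpha> + \<delta>
         \<longrightarrow> \<epsilon> \<ge> c))"
proof (intro conjI allI impI)
  have "(\<lambda>n. 2 / real n) \<in> O(\<lambda>n. ln (real n) / real n)"
    by real_asymp
  then show "\<exists>\<delta>\<^sub>0 :: nat \<Rightarrow> real.
      \<delta>\<^sub>0 \<in> O(\<lambda>n. ln (real n) / real n) \<and>
      (\<forall>(n::nat) (k::nat) (\<alpha>::real) (\<delta>::real) (\<epsilon>::real) (T::nat set)
          (Enc :: bool list \<Rightarrow> bool list pmf) (Dec :: bool list \<Rightarrow> bool list option).
         n \<ge> 2 \<and> \<alpha> \<in> {0<..<1} \<and>
         T \<subseteq> {..<n} \<and> real (card T) = \<alpha> * real n \<and>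
         coding_scheme n k Enc Dec \<and>
         non_malleable k Enc Dec (tampering_on n T) \<epsilon> \<and>
         \<delta> \<in> {\<delta>\<^sub>0 n..\<alpha>} \<and> rate n k = 1 - \<alpha> + \<delta>
         \<longrightarrow> \<epsilon> \<ge> \<delta> / (16 * \<alpha>))"
    by (intro exI[of _ "\<lambda>n. 2 / real n"] conjI) (auto intro: non_malleable_rate_bound)
next
  fix \<alpha> \<delta> :: real
  assume "\<alpha> \<in> {0<..<1} \<and> \<delta> \<in> {0<..\<alpha>}"
  then have pos: "0 < \<alpha>" "0 < \<delta>" "\<delta> \<le> \<alpha>" by auto
  have "(\<lambda>n. 2 / real n) \<longlonglongrightarrow> 0" by real_asymp
  \<comment> \<open>A fixed \<delta> eventually exceeds the vanishing threshold, and the resulting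
    bound is a positive constant independent of \<open>n\<close>.\<close>
  then have "\<forall>\<^sub>F n in sequentially. 2 / real n < \<delta>"
    using pos(2) by (rule order_tendstoD)
  then have "\<forall>\<^sub>F n in sequentially. \<forall>(k::nat) (\<epsilon>::real) (T::nat set)
          (Enc :: bool list \<Rightarrow> bool list pmf) (Dec :: bool list \<Rightarrow> bool list option).
         T \<subseteq> {..<n} \<and> real (card T) = \<alpha> * real n \<and>
         coding_scheme n k Enc Dec \<and>
         non_malleable k Enc Dec (tampering_on n T) \<epsilon> \<and>
         rate n k = 1 - \<alpha> + \<delta>
         \<longrightarrow> \<epsilon> \<ge> \<delta> / (16 * \<alpha>)"
    using eventually_ge_at_top[of 2]
  proof eventually_elim
    case (elim n)
    with pos(3) show ?case by (auto intro: non_malleable_rate_bound)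
  qed
  with pos show "\<exists>c>0. \<forall>\<^sub>F n in sequentially. \<forall>(k::nat) (\<epsilon>::real) (T::nat set)
          (Enc :: bool list \<Rightarrow> bool list pmf) (Dec :: bool list \<Rightarrow> bool list option).
         T \<subseteq> {..<n} \<and> real (card T) = \<alpha> * real n \<and>
         coding_scheme n k Enc Dec \<and>
         non_malleable k Enc Dec (tampering_on n T) \<epsilon> \<and>
         rate n k = 1 - \<alpha> + \<delta>
         \<longrightarrow> \<epsilon> \<ge> c"
    by (intro exI[of _ "\<delta> / (16 * \<alpha>)"]) auto
qed

end
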